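(* Let $R$ be a commutative ring with identity and let $I$ be a non-zero ideal of $R$. The following are equivalent: (a) the graph $\Gamma(R\Join I)$ is a complete graph; (b) $(\mathrm{Z}(R))^2=0$ and $I\subseteq\mathrm{Z}(R)$; (c) $(\mathrm{Z}(R\Join I))^2=0$.
   Context: $R\Join I=\{(r,r+i)\mid r\in R,\ i\in I\}$ is the subring of $R\times R$ (componentwise operations), called the amalgamated duplication of $R$ along $I$. For a commutative ring $A$, $\mathrm{Z}(A)$ denotes the set of zero-divisors of $A$ (including $0$), and $(\mathrm{Z}(A))^2=0$ means $xy=0$ for all $x,y\in\mathrm{Z}(A)$. $\Gamma(A)$ is the zero-divisor graph: its vertices are the non-zero zero-divisors of $A$, and distinct vertices $x,y$ are adjacent iff $xy=0$. A graph is complete if every two distinct vertices are adjacent.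
   Formalization: The formal theorem excludes the single case where R has exactly two elements and I = R; there R⋈I is F_2×F_2, whose zero-divisor graph is complete although (b) and (c) fail, so the statement as printed is false in that case. *)

theory Defs
  imports "HOL-Algebra.Algebra" "HOL-Library.Ramsey"
begin

definition amalg_carrier :: "('a, 'm) ring_scheme \<Rightarrow> 'a set \<Rightarrow> ('a \<times> 'a) set"
  where "amalg_carrier R I = {(r, r \<oplus>\<^bsub>R\<^esub> i) | r i. r \<in> carrier R \<and> i \<in> I}"

text \<open>The amalgamated duplication, with the operations inherited from the direct product ring.\<close>

definition amalgamated_duplication :: "('a, 'm) ring_scheme \<Rightarrow> 'a set \<Rightarrow> ('a \<times> 'a) ring"
    (infixl \<open>\<bowtie>\<close> 75)
  where "R \<bowtie> I = (RDirProd R R) \<lparr>carrier := amalg_carrier R I\<rparr>"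

text \<open>In a non-zero ring this set contains zero, because the witness \<open>y\<close> is the only
  element required to be non-zero. The definition is meant for commutative rings.\<close>

definition zero_divisors :: "('a, 'm) ring_scheme \<Rightarrow> 'a set"
  where "zero_divisors A =
    {x \<in> carrier A. \<exists>y \<in> carrier A. y \<noteq> \<zero>\<^bsub>A\<^esub> \<and> x \<otimes>\<^bsub>A\<^esub> y = \<zero>\<^bsub>A\<^esub>}"

definition zero_divisors_square_zero :: "('a, 'm) ring_scheme \<Rightarrow> bool"
  where "zero_divisors_square_zero A \<longleftrightarrow>
    (\<forall>x \<in> zero_divisors A. \<forall>y \<in> zero_divisors A. x \<otimes>\<^bsub>A\<^esub> y = \<zero>\<^bsub>A\<^esub>)"

text \<open>A simple graph is a pair of a vertex set and a set of two-element edges; neither need be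
  finite.\<close>

definition zero_divisor_graph :: "('a, 'm) ring_scheme \<Rightarrow> 'a set \<times> 'a set set"
  where "zero_divisor_graph A =
    (zero_divisors A - {\<zero>\<^bsub>A\<^esub>},
     {{x, y} | x y. x \<in> zero_divisors A - {\<zero>\<^bsub>A\<^esub>} \<and> y \<in> zero_divisors A - {\<zero>\<^bsub>A\<^esub>} \<and>
                    x \<noteq> y \<and> x \<otimes>\<^bsub>A\<^esub> y = \<zero>\<^bsub>A\<^esub>})"

definition complete_graph :: "'a set \<times> 'a set set \<Rightarrow> bool"
  where "complete_graph G \<longleftrightarrow> clique (fst G) (snd G)"

lemma (in cring) complete_zero_divisor_graph_iff:
  "complete_graph (zero_divisor_graph R) \<longleftrightarrow>
    (\<forall>x \<in> zero_divisors R - {\<zero>}. \<forall>y \<in> zero_divisors R - {\<zero>}. x \<noteq> y \<longrightarrow> x \<otimes> y = \<zero>)"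
proof -
  let ?V = "zero_divisors R - {\<zero>}"
  have comm: "x \<otimes> y = y \<otimes> x" if "x \<in> ?V" "y \<in> ?V" for x y
    using that by (auto simp: zero_divisors_def m_comm)
  have "{v, w} \<in> snd (zero_divisor_graph R) \<longleftrightarrow> v \<otimes> w = \<zero>"
    if "v \<in> ?V" "w \<in> ?V" "v \<noteq> w" for v w
  proof
    assume "{v, w} \<in> snd (zero_divisor_graph R)"
    then obtain x y where "{v, w} = {x, y}" "x \<otimes> y = \<zero>"
      unfolding zero_divisor_graph_def by auto
    then show "v \<otimes> w = \<zero>"
      using comm[OF that(1,2)] by (auto simp: doubleton_eq_iff)
  next
    assume "v \<otimes> w = \<zero>"
    with that show "{v, w} \<in> snd (zero_divisor_graph R)"
      unfolding zero_divisor_graph_def snd_conv by blast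
  qed
  moreover have "fst (zero_divisor_graph R) = ?V"
    by (simp add: zero_divisor_graph_def)
  ultimately show ?thesis
    unfolding complete_graph_def clique_def by simp
qed

lemma amalgamated_duplication_simps [simp]:
  "carrier (R \<bowtie> I) = amalg_carrier R I"
  "(a, b) \<otimes>\<^bsub>R \<bowtie> I\<^esub> (c, d) = (a \<otimes>\<^bsub>R\<^esub> c, b \<otimes>\<^bsub>R\<^esub> d)"
  "(a, b) \<oplus>\<^bsub>R \<bowtie> I\<^esub> (c, d) = (a \<oplus>\<^bsub>R\<^esub> c, b \<oplus>\<^bsub>R\<^esub> d)"
  "\<one>\<^bsub>R \<bowtie> I\<^esub> = (\<one>\<^bsub>R\<^esub>, \<one>\<^bsub>R\<^esub>)"
  "\<zero>\<^bsub>R \<bowtie> I\<^esub> = (\<zero>\<^bsub>R\<^esub>, \<zero>\<^bsub>R\<^esub>)"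
  by (simp_all add: amalgamated_duplication_def RDirProd_def DirProd_def monoid.defs)

lemma amalg_carrier_alt:
  assumes "cring R" and "ideal I R"
  shows "amalg_carrier R I = {(a, b). a \<in> carrier R \<and> b \<in> carrier R \<and> b \<ominus>\<^bsub>R\<^esub> a \<in> I}"
proof -
  interpret cring R by fact
  interpret ideal I R by fact
  have 1: "(r \<oplus>\<^bsub>R\<^esub> i) \<ominus>\<^bsub>R\<^esub> r = i" if "r \<in> carrier R" "i \<in> I" for r i
    using that Icarr by algebra
  have 2: "b = a \<oplus>\<^bsub>R\<^esub> (b \<ominus>\<^bsub>R\<^esub> a)" if "a \<in> carrier R" "b \<in> carrier R" for a b
    using that by algebra
  show ?thesis
    unfolding amalg_carrier_def using 1 Icarr by (auto intro: 2)
qed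

lemma amalg_subcring:
  assumes "cring R" and "ideal I R"
  shows "subcring (amalg_carrier R I) (RDirProd R R)"
proof -
  interpret R: cring R by fact
  interpret I: ideal I R by fact
  interpret P: ring "RDirProd R R" by (rule RDirProd_ring) unfold_locales
  note alt = amalg_carrier_alt[OF assms]
  note ops = RDirProd_def DirProd_def monoid.defs
  have mult: "b \<otimes>\<^bsub>R\<^esub> d \<ominus>\<^bsub>R\<^esub> a \<otimes>\<^bsub>R\<^esub> c \<in> I"
    if "a \<in> carrier R" "b \<in> carrier R" "c \<in> carrier R" "d \<in> carrier R"
      "b \<ominus>\<^bsub>R\<^esub> a \<in> I" "d \<ominus>\<^bsub>R\<^esub> c \<in> I" for a b c d
  proof -
    have "b \<otimes>\<^bsub>R\<^esub> d \<ominus>\<^bsub>R\<^esub> a \<otimes>\<^bsub>R\<^esub> c = b \<otimes>\<^bsub>R\<^esub> (d \<ominus>\<^bsub>R\<^esub> c) \<oplus>\<^bsub>R\<^esub> c \<otimes>\<^bsub>R\<^esub> (b \<ominus>\<^bsub>R\<^esub> a)"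
      using that by algebra
    then show ?thesis using that I.I_l_closed by simp
  qed
  have add: "(b \<oplus>\<^bsub>R\<^esub> d) \<ominus>\<^bsub>R\<^esub> (a \<oplus>\<^bsub>R\<^esub> c) \<in> I"
    if "a \<in> carrier R" "b \<in> carrier R" "c \<in> carrier R" "d \<in> carrier R"
      "b \<ominus>\<^bsub>R\<^esub> a \<in> I" "d \<ominus>\<^bsub>R\<^esub> c \<in> I" for a b c d
  proof -
    have "(b \<oplus>\<^bsub>R\<^esub> d) \<ominus>\<^bsub>R\<^esub> (a \<oplus>\<^bsub>R\<^esub> c) = (b \<ominus>\<^bsub>R\<^esub> a) \<oplus>\<^bsub>R\<^esub> (d \<ominus>\<^bsub>R\<^esub> c)"
      using that by algebra
    then show ?thesis using that by simp
  qed
  have neg: "\<ominus>\<^bsub>R\<^esub> b \<ominus>\<^bsub>R\<^esub> (\<ominus>\<^bsub>R\<^esub> a) \<in> I"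
    if "a \<in> carrier R" "b \<in> carrier R" "b \<ominus>\<^bsub>R\<^esub> a \<in> I" for a b
  proof -
    have "\<ominus>\<^bsub>R\<^esub> b \<ominus>\<^bsub>R\<^esub> (\<ominus>\<^bsub>R\<^esub> a) = \<ominus>\<^bsub>R\<^esub> (b \<ominus>\<^bsub>R\<^esub> a)" using that by algebra
    then show ?thesis using that by simp
  qed
  have inv: "\<ominus>\<^bsub>RDirProd R R\<^esub> (a, b) = (\<ominus>\<^bsub>R\<^esub> a, \<ominus>\<^bsub>R\<^esub> b)"
    if "a \<in> carrier R" "b \<in> carrier R" for a b
    by (rule P.minus_equality) (use that in \<open>auto simp: ops R.l_neg\<close>)
  have "subring (amalg_carrier R I) (RDirProd R R)"
  proof (rule P.subringI)
    show "amalg_carrier R I \<subseteq> carrier (RDirProd R R)"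
      by (auto simp: alt RDirProd_carrier)
    show "\<one>\<^bsub>RDirProd R R\<^esub> \<in> amalg_carrier R I"
      by (auto simp: alt ops R.minus_eq R.r_neg)
  qed (use mult add neg inv in \<open>auto simp: alt ops\<close>)
  then show ?thesis
    by (rule P.subcringI) (auto simp: alt ops R.m_comm)
qed

lemma amalg_cring:
  assumes "cring R" and "ideal I R"
  shows "cring (R \<bowtie> I)"
proof -
  interpret cring R by fact
  interpret P: ring "RDirProd R R" by (rule RDirProd_ring) unfold_locales
  show ?thesis
    using P.subcring_iff amalg_subcring[OF assms] subcringE(1)
    unfolding amalgamated_duplication_def by blast
qed

text \<open>The field with two elements, duplicated along itself, is the product of two copies of that
  field. Its zero-divisor graph is the complete graph on \<open>(1, 0)\<close> and \<open>(0, 1)\<close>, although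
  these vertices are idempotent. So completeness of the graph does not force the zero-divisors
  to have square zero in this one case, which the equivalence has to exclude.\<close>

lemma two_element_ring_exception:
  assumes "cring R" and card: "card (carrier R) = 2"
  shows "complete_graph (zero_divisor_graph (R \<bowtie> carrier R))"
    and "\<not> carrier R \<subseteq> zero_divisors R"
    and "\<not> zero_divisors_square_zero (R \<bowtie> carrier R)"
proof -
  interpret cring R by fact
  have ne: "\<one>\<^bsub>R\<^esub> \<noteq> \<zero>\<^bsub>R\<^esub>"
    using card carrier_one_zero by force
  have "{\<zero>\<^bsub>R\<^esub>, \<one>\<^bsub>R\<^esub>} = carrier R"
    by (rule card_subset_eq) (use card ne in \<open>auto intro: card_ge_0_finite\<close>)
  then have C: "carrier R = {\<zero>\<^bsub>R\<^esub>, \<one>\<^bsub>R\<^esub>}" by simp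
  have A: "amalg_carrier R (carrier R) = carrier R \<times> carrier R"
    using amalg_carrier_alt[OF \<open>cring R\<close> oneideal] by auto
  have Z: "zero_divisors (R \<bowtie> carrier R) =
      {(\<zero>\<^bsub>R\<^esub>, \<zero>\<^bsub>R\<^esub>), (\<one>\<^bsub>R\<^esub>, \<zero>\<^bsub>R\<^esub>), (\<zero>\<^bsub>R\<^esub>, \<one>\<^bsub>R\<^esub>)}"
    unfolding zero_divisors_def using ne by (auto simp: A[unfolded C] C)
  show "complete_graph (zero_divisor_graph (R \<bowtie> carrier R))"
    unfolding cring.complete_zero_divisor_graph_iff[OF amalg_cring[OF \<open>cring R\<close> oneideal]] Z
    by auto
  show "\<not> carrier R \<subseteq> zero_divisors R"
    unfolding zero_divisors_def using ne by auto
  show "\<not> zero_divisors_square_zero (R \<bowtie> carrier R)"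
    unfolding zero_divisors_square_zero_def Z using ne by auto
qed

end

theory Submission
  imports Defs
begin

text \<open>The implications from (b) to (c) and from (c) to (b) are element chases with the pairs
  \<open>(x, x)\<close> and \<open>(i, 0)\<close>, \<open>(0, i)\<close> for \<open>i \<in> I\<close>. For the step from (a) to (c), suppose that the
  graph of a ring \<open>A\<close> is complete and that some zero-divisor \<open>x\<close> has \<open>x\<^sup>2 \<noteq> 0\<close>. Comparing \<open>x\<close>
  with \<open>x\<^sup>2\<close> and with \<open>x + x\<^sup>2\<close> shows that \<open>x\<close> is idempotent, and then both \<open>x\<close> and \<open>1 - x\<close>
  generate ideals with two elements, so \<open>A = {0, 1, x, 1 - x}\<close>. In \<open>A = R \<bowtie> I\<close> the distinct
  elements \<open>(i, 0)\<close> and \<open>(0, i)\<close>, with \<open>i \<noteq> 0\<close>, can only be \<open>x\<close> and \<open>1 - x\<close>, so that \<open>i = 1\<close>.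
  Hence \<open>I = R = {0, 1}\<close>, which is the excluded case.\<close>

context cring
begin

lemma zero_divisorsI:
  assumes "x \<in> carrier R" "y \<in> carrier R" "y \<noteq> \<zero>" "x \<otimes> y = \<zero>"
  shows "x \<in> zero_divisors R"
  using assms unfolding zero_divisors_def by blast

lemma zero_divisorsE:
  assumes "x \<in> zero_divisors R"
  obtains y where "x \<in> carrier R" "y \<in> carrier R" "y \<noteq> \<zero>" "x \<otimes> y = \<zero>"
  using assms unfolding zero_divisors_def by blast

text \<open>Zero is not a vertex but annihilates everything, so adjacency extends to all distinct
  zero-divisors. Later products can thus be compared without first checking that they are
  non-zero.\<close>

lemma mult_eq_zero_if_complete_graph:
  assumes "complete_graph (zero_divisor_graph R)"
    and "x \<in> zero_divisors R" "y \<in> zero_divisors R" "x \<noteq> y"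
  shows "x \<otimes> y = \<zero>"
proof (cases "x = \<zero> \<or> y = \<zero>")
  case True
  then show ?thesis using assms(2,3) by (auto elim!: zero_divisorsE)
next
  case False
  then show ?thesis using assms by (simp add: complete_zero_divisor_graph_iff)
qed

lemma complete_graph_if_zero_divisors_square_zero:
  "zero_divisors_square_zero R \<Longrightarrow> complete_graph (zero_divisor_graph R)"
  by (simp add: complete_zero_divisor_graph_iff zero_divisors_square_zero_def)

text \<open>If \<open>x\<close> and its square differ, completeness makes the cube of
  \<open>x\<close> vanish. Then the non-zero square annihilates
  \<open>x \<oplus> x \<otimes> x\<close>, a zero-divisor other than \<open>x\<close>, and
  multiplying it by \<open>x\<close> leaves the square, which must be zero.\<close>

lemma idempotent_if_complete_graph:
  assumes compl: "complete_graph (zero_divisor_graph R)"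
    and x: "x \<in> zero_divisors R" "x \<otimes> x \<noteq> \<zero>"
  shows "x \<otimes> x = x"
proof (rule ccontr)
  assume neq: "x \<otimes> x \<noteq> x"
  obtain y where c: "x \<in> carrier R" "y \<in> carrier R" "y \<noteq> \<zero>" "x \<otimes> y = \<zero>"
    using x(1) by (rule zero_divisorsE)
  have "x \<otimes> x \<in> zero_divisors R"
    by (rule zero_divisorsI[of _ y]) (use c in \<open>simp_all add: m_assoc\<close>)
  then have cube: "x \<otimes> (x \<otimes> x) = \<zero>"
    using mult_eq_zero_if_complete_graph[OF compl x(1)] neq by metis
  have "(x \<oplus> x \<otimes> x) \<otimes> (x \<otimes> x) = x \<otimes> (x \<otimes> x) \<oplus> x \<otimes> (x \<otimes> (x \<otimes> x))"
    using c by (simp add: l_distr m_assoc)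
  then have "(x \<oplus> x \<otimes> x) \<otimes> (x \<otimes> x) = \<zero>"
    using c cube by simp
  then have sum: "x \<oplus> x \<otimes> x \<in> zero_divisors R"
    using c x(2) by (intro zero_divisorsI[of _ "x \<otimes> x"]) auto
  have "x \<noteq> x \<oplus> x \<otimes> x"
    using c x(2) by (metis a_comm add.l_cancel_one' m_closed r_zero)
  then have "x \<otimes> (x \<oplus> x \<otimes> x) = \<zero>"
    using mult_eq_zero_if_complete_graph[OF compl x(1) sum] by simp
  then show False
    using c cube x(2) by (simp add: r_distr)
qed

text \<open>Whatever annihilates \<open>x\<close> annihilates \<open>r \<otimes> x\<close>. If this
  multiple differs from \<open>x\<close>, its product with \<open>x\<close> is zero, but idempotence
  makes that product the multiple itself.\<close>

lemma idempotent_multiple_if_complete_graph: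
  assumes compl: "complete_graph (zero_divisor_graph R)"
    and x: "x \<in> zero_divisors R" "x \<otimes> x = x" and r: "r \<in> carrier R"
  shows "r \<otimes> x = \<zero> \<or> r \<otimes> x = x"
proof (rule disjCI)
  assume neq: "r \<otimes> x \<noteq> x"
  obtain y where c: "x \<in> carrier R" "y \<in> carrier R" "y \<noteq> \<zero>" "x \<otimes> y = \<zero>"
    using x(1) by (rule zero_divisorsE)
  have "r \<otimes> x \<in> zero_divisors R"
    by (rule zero_divisorsI[of _ y]) (use c r in \<open>simp_all add: m_assoc\<close>)
  then have "(r \<otimes> x) \<otimes> x = \<zero>"
    using mult_eq_zero_if_complete_graph[OF compl _ x(1)] neq by simp
  then show "r \<otimes> x = \<zero>"
    using c r x(2) by (simp add: m_assoc)
qed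

text \<open>By the Peirce decomposition, \<open>r\<close> is the sum of its multiples of the
  orthogonal idempotents \<open>x\<close> and \<open>\<one> \<ominus> x\<close>, and each summand
  has only two possible values.\<close>

lemma carrier_subset_if_complete_graph:
  assumes compl: "complete_graph (zero_divisor_graph R)"
    and x: "x \<in> zero_divisors R" "x \<otimes> x \<noteq> \<zero>"
  shows "carrier R \<subseteq> {\<zero>, \<one>, x, \<one> \<ominus> x}"
proof
  fix r assume r: "r \<in> carrier R"
  have idem: "x \<otimes> x = x"
    using assms by (rule idempotent_if_complete_graph)
  have c: "x \<in> carrier R"
    using x(1) by (rule zero_divisorsE)
  let ?y = "\<one> \<ominus> x"
  have "?y \<otimes> x = x \<ominus> x \<otimes> x" using c by algebra
  then have "?y \<otimes> x = \<zero>" using c idem by (simp add: r_neg minus_eq)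
  then have y: "?y \<in> zero_divisors R"
    using c x(2) by (intro zero_divisorsI[of _ x]) auto
  have "?y \<otimes> ?y = ?y \<ominus> ?y \<otimes> x" using c by algebra
  then have "?y \<otimes> ?y = ?y" using c \<open>?y \<otimes> x = \<zero>\<close> by (simp add: minus_eq)
  then have "r \<otimes> ?y = \<zero> \<or> r \<otimes> ?y = ?y"
    using idempotent_multiple_if_complete_graph[OF compl y] r by simp
  moreover have "r \<otimes> x = \<zero> \<or> r \<otimes> x = x"
    using idempotent_multiple_if_complete_graph[OF compl x(1) idem r] .
  moreover have "x \<oplus> ?y = \<one>" using c by algebra
  ultimately have "r \<otimes> x \<oplus> r \<otimes> ?y \<in> {\<zero>, \<one>, x, ?y}"
    using c by (elim disjE) simp_all
  moreover have "r \<otimes> x \<oplus> r \<otimes> ?y = r" using r c by algebra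
  ultimately show "r \<in> {\<zero>, \<one>, x, ?y}" by simp
qed

end

lemma (in ideal) nonzero_elementE:
  assumes "I \<noteq> {\<zero>}"
  obtains i where "i \<in> I" "i \<noteq> \<zero>"
proof -
  have "\<zero> \<in> I" by (rule additive_subgroup.zero_closed[OF additive_subgroup_axioms])
  then have "\<not> I \<subseteq> {\<zero>}" using assms by (metis empty_iff subset_singletonD)
  then show thesis using that by blast
qed

lemma (in ideal) fst_snd_mem_amalg_carrier:
  assumes "i \<in> I"
  shows "(i, \<zero>) \<in> amalg_carrier R I" "(\<zero>, i) \<in> amalg_carrier R I"
proof -
  have i: "i \<in> carrier R" "\<ominus> i \<in> I" using assms Icarr by simp_all
  have "(i, i \<oplus> \<ominus> i) \<in> amalg_carrier R I"
    unfolding amalg_carrier_def using i by blast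
  then show "(i, \<zero>) \<in> amalg_carrier R I" using i(1) by (simp add: r_neg)
  have "(\<zero>, \<zero> \<oplus> i) \<in> amalg_carrier R I"
    unfolding amalg_carrier_def using assms by blast
  then show "(\<zero>, i) \<in> amalg_carrier R I" using i(1) by simp
qed

lemma (in ideal) diagonal_mem_amalg_carrier:
  assumes "r \<in> carrier R"
  shows "(r, r) \<in> amalg_carrier R I"
proof -
  have "(r, r \<oplus> \<zero>) \<in> amalg_carrier R I"
    unfolding amalg_carrier_def
    using assms additive_subgroup.zero_closed[OF additive_subgroup_axioms] by blast
  then show ?thesis using assms by simp
qed

lemma (in ideal) two_element_ring_if_complete_graph:
  assumes "cring R" and nontrivial: "I \<noteq> {\<zero>}"
    and compl: "complete_graph (zero_divisor_graph (R \<bowtie> I))"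
    and not_sq: "\<not> zero_divisors_square_zero (R \<bowtie> I)"
  shows "card (carrier R) = 2 \<and> I = carrier R"
proof -
  interpret cring R by fact
  interpret A: cring "R \<bowtie> I" using \<open>cring R\<close> is_ideal by (rule amalg_cring)
  obtain x y where xy: "x \<in> zero_divisors (R \<bowtie> I)" "y \<in> zero_divisors (R \<bowtie> I)"
      "x \<otimes>\<^bsub>R \<bowtie> I\<^esub> y \<noteq> \<zero>\<^bsub>R \<bowtie> I\<^esub>"
    using not_sq unfolding zero_divisors_square_zero_def by blast
  \<comment> \<open>Completeness controls products of distinct elements only, so the failing pair is
    a single element with non-zero square.\<close>
  then have "x = y"
    using A.mult_eq_zero_if_complete_graph[OF compl] by blast
  then have sub: "amalg_carrier R I \<subseteq> {(\<zero>, \<zero>), (\<one>, \<one>), x, \<one>\<^bsub>R \<bowtie> I\<^esub> \<ominus>\<^bsub>R \<bowtie> I\<^esub> x}"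
    using A.carrier_subset_if_complete_graph[OF compl] xy by auto
  have "x \<in> carrier (R \<bowtie> I)"
    using xy(1) by (rule A.zero_divisorsE)
  \<comment> \<open>Both orders are recorded because either of \<open>(i, \<zero>)\<close> and
    \<open>(\<zero>, i)\<close> may turn out to be \<open>x\<close>.\<close>
  then have sum: "x \<oplus>\<^bsub>R \<bowtie> I\<^esub> (\<one>\<^bsub>R \<bowtie> I\<^esub> \<ominus>\<^bsub>R \<bowtie> I\<^esub> x) = (\<one>, \<one>)"
      "(\<one>\<^bsub>R \<bowtie> I\<^esub> \<ominus>\<^bsub>R \<bowtie> I\<^esub> x) \<oplus>\<^bsub>R \<bowtie> I\<^esub> x = (\<one>, \<one>)"
    unfolding amalgamated_duplication_simps(4)[of R I, symmetric] by algebra+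
  have eq_one: "i = \<one>" if "i \<in> I" "i \<noteq> \<zero>" for i
  proof -
    have i: "i \<in> carrier R" using that Icarr by blast
    then have "\<one> \<noteq> \<zero>" using that(2) by (metis l_null l_one)
    then have "(i, \<zero>) \<in> {x, \<one>\<^bsub>R \<bowtie> I\<^esub> \<ominus>\<^bsub>R \<bowtie> I\<^esub> x}"
        "(\<zero>, i) \<in> {x, \<one>\<^bsub>R \<bowtie> I\<^esub> \<ominus>\<^bsub>R \<bowtie> I\<^esub> x}"
      using fst_snd_mem_amalg_carrier[OF that(1), THEN subsetD[OF sub]] that(2)
      by auto
    moreover have "(i, \<zero>) \<noteq> (\<zero>, i)" using that(2) by simp
    ultimately have "(i, \<zero>) \<oplus>\<^bsub>R \<bowtie> I\<^esub> (\<zero>, i) = (\<one>, \<one>)"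
      using sum by (elim insertE emptyE) simp_all
    then show ?thesis using i by simp
  qed
  obtain i where i: "i \<in> I" "i \<noteq> \<zero>" using nontrivial by (rule nonzero_elementE)
  then have "I = carrier R" using eq_one one_imp_carrier by blast
  moreover have "\<one> \<noteq> \<zero>" using eq_one i by blast
  moreover from calculation have "carrier R = {\<zero>, \<one>}" using eq_one by auto
  ultimately show ?thesis by simp
qed

text \<open>For a non-zero \<open>j\<close> in \<open>I\<close>, the zero-divisors of
  \<open>R\<close> are exactly the annihilator of \<open>j\<close>, an ideal containing
  \<open>I\<close>. The coordinates of a pair in the duplication differ by an element of
  \<open>I\<close>, so one is a zero-divisor iff the other is.\<close>

lemma (in ideal) zero_divisors_square_zero_amalgI:
  assumes "cring R" and nontrivial: "I \<noteq> {\<zero>}"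
    and sq: "zero_divisors_square_zero R" and sub: "I \<subseteq> zero_divisors R"
  shows "zero_divisors_square_zero (R \<bowtie> I)"
proof -
  interpret cring R by fact
  obtain j where j: "j \<in> I" "j \<noteq> \<zero>" using nontrivial by (rule nonzero_elementE)
  then have jc: "j \<in> carrier R" using Icarr by blast
  have zd_iff: "a \<in> zero_divisors R \<longleftrightarrow> a \<in> carrier R \<and> a \<otimes> j = \<zero>" for a
    using sq sub j jc zero_divisorsI unfolding zero_divisors_square_zero_def
    by (blast elim: zero_divisorsE)
  have mem: "a \<in> zero_divisors R \<longleftrightarrow> b \<in> zero_divisors R"
    if "(a, b) \<in> amalg_carrier R I" for a b
  proof -
    from that obtain i where i: "a \<in> carrier R" "i \<in> I" "b = a \<oplus> i"
      unfolding amalg_carrier_def by blast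
    then have "i \<in> carrier R" "i \<otimes> j = \<zero>" using sub zd_iff by blast+
    then have "b \<otimes> j = a \<otimes> j" using i jc by (simp add: l_distr)
    then show ?thesis using i \<open>i \<in> carrier R\<close> by (simp add: zd_iff)
  qed
  have comp: "a \<in> zero_divisors R \<and> b \<in> zero_divisors R"
    if "(a, b) \<in> zero_divisors (R \<bowtie> I)" for a b
  proof -
    from that obtain c d where ab: "(a, b) \<in> amalg_carrier R I"
      and cd: "(c, d) \<in> amalg_carrier R I" "c \<noteq> \<zero> \<or> d \<noteq> \<zero>" "a \<otimes> c = \<zero>" "b \<otimes> d = \<zero>"
      unfolding zero_divisors_def by fastforce
    have "a \<in> carrier R" "b \<in> carrier R" "c \<in> carrier R" "d \<in> carrier R"
      using ab cd(1) unfolding amalg_carrier_alt[OF \<open>cring R\<close> is_ideal] by auto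
    \<comment> \<open>The annihilating pair is sure to be non-zero in one coordinate only;
      \<open>mem\<close> carries the conclusion to the other.\<close>
    then have "a \<in> zero_divisors R \<or> b \<in> zero_divisors R"
      using cd by (blast intro: zero_divisorsI)
    then show ?thesis using mem[OF ab] by blast
  qed
  show ?thesis
    unfolding zero_divisors_square_zero_def
    using comp sq by (auto simp: zero_divisors_square_zero_def)
qed

text \<open>The diagonal embedding preserves zero-divisors, so their products vanish already in
  \<open>R\<close>. For \<open>i\<close> in \<open>I\<close>, the pair \<open>(i, \<zero>)\<close>
  is annihilated by \<open>(\<zero>, j)\<close>, so \<open>i\<close> has square zero.\<close>

lemma (in ideal) zero_divisors_square_zero_amalgD:
  assumes "cring R" and nontrivial: "I \<noteq> {\<zero>}"
    and sq: "zero_divisors_square_zero (R \<bowtie> I)"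
  shows "zero_divisors_square_zero R" "I \<subseteq> zero_divisors R"
proof -
  interpret cring R by fact
  interpret A: cring "R \<bowtie> I" using \<open>cring R\<close> is_ideal by (rule amalg_cring)
  have diag: "(x, x) \<in> zero_divisors (R \<bowtie> I)" if x: "x \<in> zero_divisors R" for x
  proof -
    obtain y where "x \<in> carrier R" "y \<in> carrier R" "y \<noteq> \<zero>" "x \<otimes> y = \<zero>"
      using x by (rule zero_divisorsE)
    then show ?thesis
      by (intro A.zero_divisorsI[of _ "(y, y)"]) (auto simp: diagonal_mem_amalg_carrier)
  qed
  show "zero_divisors_square_zero R"
    unfolding zero_divisors_square_zero_def
    using sq diag by (force simp: zero_divisors_square_zero_def)
  obtain j where j: "j \<in> I" "j \<noteq> \<zero>" using nontrivial by (rule nonzero_elementE)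
  show "I \<subseteq> zero_divisors R"
  proof
    fix i assume i: "i \<in> I"
    have ic: "i \<in> carrier R" and jc: "j \<in> carrier R" using i j Icarr by blast+
    have "(i, \<zero>) \<in> zero_divisors (R \<bowtie> I)"
      using i j ic jc fst_snd_mem_amalg_carrier
      by (intro A.zero_divisorsI[of _ "(\<zero>, j)"]) auto
    then have "i \<otimes> i = \<zero>"
      using sq unfolding zero_divisors_square_zero_def by force
    \<comment> \<open>A non-zero \<open>i\<close> annihilates itself; for \<open>i = \<zero>\<close>
      the non-zero witness has to be \<open>j\<close>.\<close>
    then show "i \<in> zero_divisors R"
      using zero_divisorsI[of i i] zero_divisorsI[of i j] ic jc j by (cases "i = \<zero>") auto
  qed
qed

theorem theorem4p8:
  fixes R :: "('a, 'm) ring_scheme" and I :: "'a set"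
  assumes "cring R"
    and "ideal I R"
    and "I \<noteq> {\<zero>\<^bsub>R\<^esub>}"
    and "\<not> (card (carrier R) = 2 \<and> I = carrier R)"
  shows "(complete_graph (zero_divisor_graph (R \<bowtie> I)) \<longleftrightarrow>
            zero_divisors_square_zero R \<and> I \<subseteq> zero_divisors R)
       \<and> (zero_divisors_square_zero R \<and> I \<subseteq> zero_divisors R \<longleftrightarrow>
            zero_divisors_square_zero (R \<bowtie> I))"
proof -
  interpret ideal I R by fact
  interpret A: cring "R \<bowtie> I" using assms(1,2) by (rule amalg_cring)
  have "zero_divisors_square_zero R \<and> I \<subseteq> zero_divisors R \<longleftrightarrow>
      zero_divisors_square_zero (R \<bowtie> I)"
    using zero_divisors_square_zero_amalgI zero_divisors_square_zero_amalgD assms(1,3) by blast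
  \<comment> \<open>The exclusion of the two-element ring enters in the forward direction
    here.\<close>
  moreover have "complete_graph (zero_divisor_graph (R \<bowtie> I)) \<longleftrightarrow>
      zero_divisors_square_zero (R \<bowtie> I)"
    using two_element_ring_if_complete_graph assms(1,3,4)
      A.complete_graph_if_zero_divisors_square_zero by blast
  ultimately show ?thesis by blast
qed

end
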